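(* Let $(X,d,\mu)$ and $(X',d',\mu')$ be metric measure spaces with $X$ and $X'$ compact, and let $D_X$ and $D_{X'}$ be the diameters of $(X,d)$ and $(X',d')$. Then, for any $p\ge1$, \[ d_{GH}(\Sigma_{p,\mu},\Sigma_{p,\mu'})\le C(X,X')\,d_{KS,p}(\mu,\mu'), \] where $C(X,X')=\max\{2,2(D_X+D_{X'})\}$.
   Context: A metric measure space $(X,d,\mu)$ is a metric space with a Borel probability measure. $O(X)$ is the set of all 1-Lipschitz functions $f\colon X\to\mathbb{R}$, and $O^c_\mu=\{f\in O(X):\int_X f\,d\mu=0\}$. For $p\ge1$ let $r_{p,\mu}(f,g)=\left(\int_X|f-g|^p\,d\mu\right)^{1/p}$, and on $Q^c_{p,\mu}:=O^c_\mu\times O^c_\mu$ use the bounded pseudo metric $c_{p,\mu}((f,f'),(g,g'))=\max\{r_{p,\mu}(f,g),r_{p,\mu}(f',g')\}$. The observable covariance $\Sigma_{p,\mu}\colon Q^c_{p,\mu}\to\mathbb{R}$ is $\Sigma_{p,\mu}(f,g)=\int_X f(x)g(x)\,d\mu(x)$, viewed as a function on the pseudo metric space $(Q^c_{p,\mu},c_{p,\mu})$; similarly for $(X',d',\mu')$. Gromov-Hausdorff distance between functions: let $(Z,d_Z)$, $(Z',d_{Z'})$ be bounded pseudo metric spaces and $f\colon Z\to\mathbb{R}$, $f'\colon Z'\to\mathbb{R}$ continuous. A correspondence is a relation $R\subseteq Z\times Z'$ whose projections to $Z$ and $Z'$ are surjective. Let $dis(R)=\sup_{(z_1,z_1'),(z_2,z_2')\in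 R}|d_Z(z_1,z_2)-d_{Z'}(z_1',z_2')|$ and $fdis(R)=\sup_{(z,z')\in R}|f(z)-f'(z')|$. Then $d_{GH}(f,f')=\frac12\inf_R\max\{dis(R),2\,fdis(R)\}$, the infimum over all correspondences $R\subseteq Z\times Z'$. Kantorovich-Sturm distance: let $K\subseteq X$, $K'\subseteq X'$ be the supports of $\mu,\mu'$. A metric coupling is a metric $\delta$ on the disjoint union $X\sqcup X'$ with $\delta|_{K\times K}=d|_{K\times K}$ and $\delta|_{K'\times K'}=d'|_{K'\times K'}$; the set of these is $C((d,\mu),(d',\mu'))$. $\Gamma(\mu,\mu')$ is the set of Borel probability measures $h$ on $X\times X'$ with marginals $\mu$ and $\mu'$. For $p\ge1$, \[ d_{KS,p}(\mu,\mu')=\inf_{h\in\Gamma(\mu,\mu'),\ \delta\in C((d,\mu),(d',\mu'))}\left(\int_{X\times X'}\delta^p(x,x')\,dh(x,x')\right)^{1/p}, \] where $d_{KS,p}(\mu,\mu')$ abbreviates the distance between the metric measure spaces $(X,d,\mu)$ and $(X',d',\mu')$. Since any $h\in\Gamma(\mu,\mu')$ has support contained in $K\times K'$, integrals over $X\times X'$ against $h$ equal integrals over $K\times K'$. *)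

theory Defs
  imports "HOL-Analysis.Analysis" "HOL-Probability.Probability"
begin

text \<open>
  A metric measure space is a type of class \<open>metric_space\<close> together with a measure
  \<open>M\<close> such that \<open>prob_space M\<close> and \<open>sets M = sets borel\<close>.
\<close>

definition lip1_functions :: "('a::metric_space \<Rightarrow> real) set" where
  "lip1_functions = {f. lipschitz_on 1 UNIV f}"

definition centered_lip1 :: "'a::metric_space measure \<Rightarrow> ('a \<Rightarrow> real) set" where
  "centered_lip1 M = {f \<in> lip1_functions. has_bochner_integral M f 0}"

text \<open>
  The following three functions are real-valued Bochner integrals and therefore meaningful only
  if the integrands are integrable, e.g. for Lipschitz functions on a compact space.
\<close>

definition Lp_dist :: "real \<Rightarrow> 'a measure \<Rightarrow> ('a \<Rightarrow> real) \<Rightarrow> ('a \<Rightarrow> real) \<Rightarrow> real" where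
  "Lp_dist p M f g = (\<integral>x. \<bar>f x - g x\<bar> powr p \<partial>M) powr (1 / p)"

definition pair_dist ::
  "real \<Rightarrow> 'a measure \<Rightarrow> ('a \<Rightarrow> real) \<times> ('a \<Rightarrow> real) \<Rightarrow> ('a \<Rightarrow> real) \<times> ('a \<Rightarrow> real) \<Rightarrow> real" where
  "pair_dist p M u v = max (Lp_dist p M (fst u) (fst v)) (Lp_dist p M (snd u) (snd v))"

definition obs_cov :: "'a measure \<Rightarrow> ('a \<Rightarrow> real) \<times> ('a \<Rightarrow> real) \<Rightarrow> real" where
  "obs_cov M u = (\<integral>x. fst u x * snd u x \<partial>M)"

definition correspondences :: "'z set \<Rightarrow> 'w set \<Rightarrow> ('z \<times> 'w) set set" where
  "correspondences Z W = {R. R \<subseteq> Z \<times> W \<and> fst ` R = Z \<and> snd ` R = W}"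

definition dis :: "('z \<Rightarrow> 'z \<Rightarrow> real) \<Rightarrow> ('w \<Rightarrow> 'w \<Rightarrow> real) \<Rightarrow> ('z \<times> 'w) set \<Rightarrow> ennreal" where
  "dis dZ dW R = (SUP ((z1, w1), (z2, w2)) \<in> R \<times> R. ennreal \<bar>dZ z1 z2 - dW w1 w2\<bar>)"

definition fdis :: "('z \<Rightarrow> real) \<Rightarrow> ('w \<Rightarrow> real) \<Rightarrow> ('z \<times> 'w) set \<Rightarrow> ennreal" where
  "fdis f g R = (SUP (z, w) \<in> R. ennreal \<bar>f z - g w\<bar>)"

text \<open>
  \<open>GH_fun_dist Z dZ f W dW g\<close> is the Gromov-Hausdorff distance between the functions \<open>f\<close> on the
  pseudo metric space \<open>(Z, dZ)\<close> and \<open>g\<close> on \<open>(W, dW)\<close>. Only the values on the carriers matter.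
\<close>

definition GH_fun_dist ::
  "'z set \<Rightarrow> ('z \<Rightarrow> 'z \<Rightarrow> real) \<Rightarrow> ('z \<Rightarrow> real) \<Rightarrow>
   'w set \<Rightarrow> ('w \<Rightarrow> 'w \<Rightarrow> real) \<Rightarrow> ('w \<Rightarrow> real) \<Rightarrow> ennreal" where
  "GH_fun_dist Z dZ f W dW g =
     (INF R \<in> correspondences Z W. max (dis dZ dW R) (2 * fdis f g R)) / 2"

definition measure_support :: "'a::topological_space measure \<Rightarrow> 'a set" where
  "measure_support M = {x. \<forall>U. open U \<longrightarrow> x \<in> U \<longrightarrow> emeasure M U > 0}"

text \<open>
  The disjoint union is the sum type. A metric coupling has to agree with the given metrics on the
  supports only.
\<close>

definition metric_couplings ::
  "'a::metric_space measure \<Rightarrow> 'b::metric_space measure \<Rightarrow> ('a + 'b \<Rightarrow> 'a + 'b \<Rightarrow> real) set" where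
  "metric_couplings M N = {\<delta>. Metric_space UNIV \<delta> \<and>
     (\<forall>x\<in>measure_support M. \<forall>y\<in>measure_support M. \<delta> (Inl x) (Inl y) = dist x y) \<and>
     (\<forall>x\<in>measure_support N. \<forall>y\<in>measure_support N. \<delta> (Inr x) (Inr y) = dist x y)}"

definition measure_couplings ::
  "'a::metric_space measure \<Rightarrow> 'b::metric_space measure \<Rightarrow> ('a \<times> 'b) measure set" where
  "measure_couplings M N = {h. prob_space h \<and> sets h = sets borel \<and>
     distr h borel fst = M \<and> distr h borel snd = N}"

definition ennreal_root :: "real \<Rightarrow> ennreal \<Rightarrow> ennreal" where
  "ennreal_root p t = (if t = \<infinity> then \<infinity> else ennreal (enn2real t powr (1 / p)))"

text \<open>
  The integral is taken over the product of the supports, which on separable spaces carries all of the mass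
  of \<open>h\<close>:
  there the integrand is continuous, whereas elsewhere the coupling metric is unrelated to the
  topologies of the two spaces and need not be measurable.
\<close>

definition KS_cost ::
  "real \<Rightarrow> 'a::metric_space measure \<Rightarrow> 'b::metric_space measure \<Rightarrow>
   ('a \<times> 'b) measure \<Rightarrow> ('a + 'b \<Rightarrow> 'a + 'b \<Rightarrow> real) \<Rightarrow> ennreal" where
  "KS_cost p M N h \<delta> = ennreal_root p
     (\<integral>\<^sup>+z\<in>measure_support M \<times> measure_support N. ennreal (\<delta> (Inl (fst z)) (Inr (snd z)) powr p) \<partial>h)"

definition KS_dist ::
  "real \<Rightarrow> 'a::metric_space measure \<Rightarrow> 'b::metric_space measure \<Rightarrow> ennreal" where
  "KS_dist p M N = (INF (h, \<delta>) \<in> measure_couplings M N \<times> metric_couplings M N. KS_cost p M N h \<delta>)"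

definition GH_obs_cov ::
  "real \<Rightarrow> 'a::metric_space measure \<Rightarrow> 'b::metric_space measure \<Rightarrow> ennreal" where
  "GH_obs_cov p M N =
     GH_fun_dist (centered_lip1 M \<times> centered_lip1 M) (pair_dist p M) (obs_cov M)
                 (centered_lip1 N \<times> centered_lip1 N) (pair_dist p N) (obs_cov N)"

end

theory Submission
  imports Defs
begin

text \<open>
  Fix a measure coupling \<open>h\<close> and a metric coupling \<open>\<delta>\<close>, and let \<open>A\<close> be the \<open>L\<^sup>p(h)\<close> norm of
  \<open>\<delta>(x, x')\<close>. Since the marginals of \<open>h\<close> are the two given measures, all observables of both spaces
  become functions on one probability space, and can be compared there in \<open>L\<^sup>p(h)\<close>. Call centered
  observables \<open>f\<close> and \<open>f'\<close> close if they are within \<open>2 * A\<close> of each other in \<open>L\<^sup>p(h)\<close>.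

  Every centered observable \<open>f\<close> of one space has a close partner on the other
  (\<open>exists_partner\<close>). In the glued metric space, \<open>f\<close> extends from the support of its measure to a
  1-Lipschitz function on the other space, and the extension \<open>g\<close> satisfies
  \<open>\<bar>f x - g x'\<bar> \<le> \<delta>(x, x')\<close> on the supports (\<open>lip1_transfer\<close>), so it is within \<open>A\<close> of \<open>f\<close> in
  \<open>L\<^sup>p(h)\<close>. The mean of \<open>g\<close> is the \<open>h\<close>-integral of \<open>g - f\<close>, hence at most \<open>A\<close> in absolute
  value; subtracting it costs at most another \<open>A\<close>.

  Pairs with close components therefore form a correspondence. By the triangle inequality in
  \<open>L\<^sup>p(h)\<close> it distorts the pseudo metrics by at most \<open>4 * A\<close> (\<open>close_Lp_dist\<close>). A centered observable
  is bounded by the diameter, so writing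
  \<open>f * g - f' * g' = f * (g - g') + g' * (f - f')\<close> shows that covariances change by at most
  \<open>2 * (D + D') * A\<close> (\<open>close_obs_cov\<close>). Half of the maximum of \<open>4 * A\<close> and \<open>4 * (D + D') * A\<close> is the
  stated constant times \<open>A\<close>, and the infimum over all couplings gives the theorem.

  The two supports play symmetric roles, so the comparison is carried out in a locale that
  interprets itself with the two spaces exchanged.
\<close>

section \<open>Minkowski's inequality and the comparison of \<open>L\<^sup>1\<close> with \<open>L\<^sup>p\<close>\<close>

text \<open>
  This is Bernoulli's inequality with a real exponent. Both integral inequalities of this part
  rest on it: it bounds a first power by a \<open>p\<close>-th power in a form that can be integrated.
\<close>

lemma powr_ge_tangent:
  fixes p t :: real
  assumes "p \<ge> 1" "t \<ge> 0"
  shows "1 + p * (t - 1) \<le> t powr p"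
proof (cases "t = 0")
  case False
  then have "(t powr p) powr (1/p) * 1 powr (1 - 1/p) \<le> 1/p * t powr p + (1 - 1/p) * 1"
    using assms by (intro Youngs_inequality_0) (auto simp: field_simps)
  moreover have "(t powr p) powr (1/p) = t"
    using assms by (simp add: powr_powr)
  ultimately have "t \<le> 1/p * t powr p + (1 - 1/p)" by simp
  then have "p * t \<le> p * (1/p * t powr p + (1 - 1/p))"
    using assms by (intro mult_left_mono) auto
  then show ?thesis using assms by (simp add: algebra_simps)
qed (use assms in simp)

text \<open>
  At the mean \<open>m\<close>, the tangent bound applied to \<open>u / m\<close> and \<open>v / m\<close> has linear terms that cancel.
  The points may be \<open>0\<close>, which is needed below because differences of functions may vanish.
\<close>

lemma powr_convex_combination:
  fixes p u v l :: real
  assumes "p \<ge> 1" "u \<ge> 0" "v \<ge> 0" "0 \<le> l" "l \<le> 1"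
  shows "(l * u + (1 - l) * v) powr p \<le> l * u powr p + (1 - l) * v powr p"
proof -
  define m where "m = l * u + (1 - l) * v"
  have m0: "m \<ge> 0" unfolding m_def using assms by simp
  show ?thesis
  proof (cases "m = 0")
    case True
    then show ?thesis using assms by (simp add: m_def)
  next
    case False
    then have m: "m > 0" using m0 by simp
    have "1 = l * (1 + p * (u/m - 1)) + (1 - l) * (1 + p * (v/m - 1))"
    proof -
      have "l * (u/m) + (1 - l) * (v/m) = 1"
        using m unfolding m_def by (simp add: add_divide_distrib [symmetric])
      then have "p * (l * (u/m) + (1 - l) * (v/m)) = p" by simp
      then show ?thesis by (simp add: algebra_simps)
    qed
    also have "\<dots> \<le> l * (u/m) powr p + (1 - l) * (v/m) powr p"
      using assms m by (intro add_mono mult_left_mono powr_ge_tangent) auto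
    also have "\<dots> = (l * u powr p + (1 - l) * v powr p) / m powr p"
      using assms m by (simp add: powr_divide add_divide_distrib)
    finally have "m powr p \<le> l * u powr p + (1 - l) * v powr p"
      using m by (simp add: le_divide_eq)
    then show ?thesis by (simp add: m_def)
  qed
qed

lemma Lp_dist_le_iff:
  assumes "p \<ge> 1" "a \<ge> 0"
  shows "Lp_dist p M f g \<le> a \<longleftrightarrow> (\<integral>x. \<bar>f x - g x\<bar> powr p \<partial>M) \<le> a powr p"
proof -
  define I where "I = (\<integral>x. \<bar>f x - g x\<bar> powr p \<partial>M)"
  have I: "I \<ge> 0" unfolding I_def by (intro integral_nonneg_AE) auto
  have "I powr (1/p) \<le> a \<longleftrightarrow> I \<le> a powr p"
  proof
    assume "I powr (1/p) \<le> a"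
    then have "(I powr (1/p)) powr p \<le> a powr p" using assms by (intro powr_mono2) auto
    then show "I \<le> a powr p" using assms I by (simp add: powr_powr)
  next
    assume "I \<le> a powr p"
    then have "I powr (1/p) \<le> (a powr p) powr (1/p)" using assms I by (intro powr_mono2) auto
    then show "I powr (1/p) \<le> a" using assms by (simp add: powr_powr)
  qed
  then show ?thesis by (simp add: Lp_dist_def I_def)
qed

lemma Lp_dist_nonneg: "0 \<le> Lp_dist p M f g"
  by (simp add: Lp_dist_def)

lemma Lp_dist_commute: "Lp_dist p M f g = Lp_dist p M g f"
  by (simp add: Lp_dist_def abs_minus_commute)

text \<open>
  Minkowski's inequality. With \<open>a\<close> and \<open>b\<close> slightly larger than the two distances on the right,
  \<open>\<bar>u - v\<bar> + \<bar>v - w\<bar>\<close> is \<open>a + b\<close> times the convex combination, with weights \<open>a / (a + b)\<close> and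
  \<open>b / (a + b)\<close>, of functions \<open>\<bar>u - v\<bar> / a\<close> and \<open>\<bar>v - w\<bar> / b\<close> of norm at most 1. Convexity of the
  \<open>p\<close>-th power passes the bound on to the combination.
\<close>

lemma Lp_dist_triangle:
  assumes p: "p \<ge> 1"
    and uv: "integrable M (\<lambda>x. \<bar>u x - v x\<bar> powr p)"
    and vw: "integrable M (\<lambda>x. \<bar>v x - w x\<bar> powr p)"
    and uw: "integrable M (\<lambda>x. \<bar>u x - w x\<bar> powr p)"
  shows "Lp_dist p M u w \<le> Lp_dist p M u v + Lp_dist p M v w"
proof (rule field_le_epsilon)
  fix e :: real assume e: "e > 0"
  (* The slack keeps both divisors positive even if a distance is 0. *)
  define a where "a = Lp_dist p M u v + e / 2"
  define b where "b = Lp_dist p M v w + e / 2"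
  have ab: "a > 0" "b > 0"
    using e Lp_dist_nonneg[of p M u v] Lp_dist_nonneg[of p M v w] by (auto simp: a_def b_def)
  define l where "l = a / (a + b)"
  have l: "0 \<le> l" "l \<le> 1" "1 - l = b / (a + b)" using ab by (auto simp: l_def field_simps)
  have Ia: "(\<integral>x. \<bar>u x - v x\<bar> powr p \<partial>M) \<le> a powr p"
    using ab e p by (subst Lp_dist_le_iff [symmetric]) (auto simp: a_def)
  have Ib: "(\<integral>x. \<bar>v x - w x\<bar> powr p \<partial>M) \<le> b powr p"
    using ab e p by (subst Lp_dist_le_iff [symmetric]) (auto simp: b_def)
  let ?r = "\<lambda>x. (a + b) powr p *
    (l * (\<bar>u x - v x\<bar> powr p / a powr p) + (1 - l) * (\<bar>v x - w x\<bar> powr p / b powr p))"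
  have ir: "integrable M ?r"
    using uv vw by auto
  have pt: "\<bar>u x - w x\<bar> powr p \<le> ?r x" for x
  proof -
    have "\<bar>u x - w x\<bar> powr p \<le> (\<bar>u x - v x\<bar> + \<bar>v x - w x\<bar>) powr p"
      using p by (intro powr_mono2) auto
    also have "\<bar>u x - v x\<bar> + \<bar>v x - w x\<bar>
        = (a + b) * (l * (\<bar>u x - v x\<bar> / a) + (1 - l) * (\<bar>v x - w x\<bar> / b))"
      using ab unfolding l(3) by (simp add: l_def distrib_left)
    also have "\<dots> powr p = (a + b) powr p *
        (l * (\<bar>u x - v x\<bar> / a) + (1 - l) * (\<bar>v x - w x\<bar> / b)) powr p"
      by (rule powr_mult)
    also have "\<dots> \<le> (a + b) powr p *
        (l * (\<bar>u x - v x\<bar> / a) powr p + (1 - l) * (\<bar>v x - w x\<bar> / b) powr p)"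
      using p l ab by (intro mult_left_mono powr_convex_combination) auto
    also have "\<dots> = ?r x" using ab by (simp add: powr_divide)
    finally show ?thesis .
  qed
  have "(\<integral>x. \<bar>u x - w x\<bar> powr p \<partial>M) \<le> (\<integral>x. ?r x \<partial>M)"
    by (intro integral_mono uw ir pt)
  also have "\<dots> = (a + b) powr p * (l * ((\<integral>x. \<bar>u x - v x\<bar> powr p \<partial>M) / a powr p)
        + (1 - l) * ((\<integral>x. \<bar>v x - w x\<bar> powr p \<partial>M) / b powr p))"
    using uv vw by simp
  also have "\<dots> \<le> (a + b) powr p * (l * 1 + (1 - l) * 1)"
    using Ia Ib ab l by (intro mult_left_mono add_mono) auto
  finally have "(\<integral>x. \<bar>u x - w x\<bar> powr p \<partial>M) \<le> (a + b) powr p" by simp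
  then have "Lp_dist p M u w \<le> a + b" using ab p by (subst Lp_dist_le_iff) auto
  then show "Lp_dist p M u w \<le> Lp_dist p M u v + Lp_dist p M v w + e"
    by (simp add: a_def b_def)
qed

text \<open>
  For \<open>a\<close> slightly larger than the \<open>L\<^sup>p\<close> distance, integrate the tangent bound at
  \<open>\<bar>f x - g x\<bar> / a\<close>: as the measure has total mass 1 and the \<open>p\<close>-th power integrates to at most 1,
  the first power does too.
\<close>

lemma (in prob_space) integral_abs_le_Lp_dist:
  assumes p: "p \<ge> 1"
    and int1: "integrable M (\<lambda>x. \<bar>f x - g x\<bar>)"
    and intp: "integrable M (\<lambda>x. \<bar>f x - g x\<bar> powr p)"
  shows "(\<integral>x. \<bar>f x - g x\<bar> \<partial>M) \<le> Lp_dist p M f g"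
proof (rule field_le_epsilon)
  fix e :: real assume e: "e > 0"
  define a where "a = Lp_dist p M f g + e"
  have a: "a > 0" using e Lp_dist_nonneg[of p M f g] by (simp add: a_def)
  have Ia: "(\<integral>x. \<bar>f x - g x\<bar> powr p \<partial>M) \<le> a powr p"
    using a e p by (subst Lp_dist_le_iff [symmetric]) (auto simp: a_def)
  have "1 + p * ((\<integral>x. \<bar>f x - g x\<bar> \<partial>M) / a - 1)
      = (\<integral>x. 1 + p * (\<bar>f x - g x\<bar> / a - 1) \<partial>M)"
    using int1 by (simp add: prob_space)
  also have "\<dots> \<le> (\<integral>x. \<bar>f x - g x\<bar> powr p / a powr p \<partial>M)"
  proof (rule integral_mono)
    fix x
    have "1 + p * (\<bar>f x - g x\<bar> / a - 1) \<le> (\<bar>f x - g x\<bar> / a) powr p"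
      using p a by (intro powr_ge_tangent) auto
    then show "1 + p * (\<bar>f x - g x\<bar> / a - 1) \<le> \<bar>f x - g x\<bar> powr p / a powr p"
      using a by (simp add: powr_divide)
  qed (use int1 intp in auto)
  also have "\<dots> \<le> 1" using Ia a by simp
  finally have "(\<integral>x. \<bar>f x - g x\<bar> \<partial>M) / a \<le> 1"
    using p by (simp add: mult_le_0_iff)
  then show "(\<integral>x. \<bar>f x - g x\<bar> \<partial>M) \<le> Lp_dist p M f g + e"
    using a by (simp add: a_def)
qed

section \<open>Supports and Lipschitz functions on compact spaces\<close>

text \<open>
  The complement of the support is a union of null open sets, but possibly an uncountable one. It is
  also the countable union of the sets \<open>F n\<close> of points at distance at least \<open>1 / (n + 1)\<close> from the
  support. These are closed, hence compact, so finitely many null open sets cover each of them.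
\<close>

lemma AE_in_measure_support:
  fixes M :: "'a::metric_space measure"
  assumes M: "sets M = sets borel" and comp: "compact (UNIV :: 'a set)"
  shows "AE x in M. x \<in> measure_support M"
proof -
  define F where "F n = {x. \<forall>y\<in>measure_support M. inverse (real (Suc n)) \<le> dist x y}" for n
  have F_null: "F n \<in> null_sets M" for n
  proof -
    have "F n = (\<Inter>y\<in>measure_support M. {x. inverse (real (Suc n)) \<le> dist x y})"
      by (auto simp: F_def)
    moreover have "closed \<dots>"
      by (intro closed_INT ballI closed_Collect_le continuous_intros)
    ultimately have clF: "closed (F n)" by simp
    then have cF: "compact (F n)" using compact_Int_closed[OF comp] by simp
    let ?C = "{U. open U \<and> emeasure M U = 0}"
    have "F n \<subseteq> \<Union>?C"
    proof
      fix x assume "x \<in> F n"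
      then have "x \<notin> measure_support M" using dist_self[of x] by (force simp: F_def)
      then show "x \<in> \<Union>?C" by (auto simp: measure_support_def)
    qed
    then obtain C where C: "C \<subseteq> ?C" "finite C" "F n \<subseteq> \<Union>C"
      by (rule compactE[OF cF]) blast
    have "\<Union>C \<in> null_sets M"
    proof -
      have "(\<Union>U\<in>C. U) \<in> null_sets M"
      proof (rule null_sets_UN')
        show "countable C" using C(2) by (rule countable_finite)
        show "U \<in> null_sets M" if "U \<in> C" for U
          using subsetD[OF C(1) that] M by (auto simp: null_sets_def)
      qed
      then show ?thesis by simp
    qed
    then show ?thesis
      using C(3) borel_closed[OF clF] M by (metis null_sets_subset)
  qed
  have "- measure_support M \<subseteq> (\<Union>n. F n)"
  proof
    fix x assume "x \<in> - measure_support M"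
    then obtain U where U: "open U" "x \<in> U" "emeasure M U = 0"
      by (auto simp: measure_support_def)
    obtain r where r: "r > 0" "\<And>y. dist y x < r \<Longrightarrow> y \<in> U"
      using U(1,2) by (auto simp: open_dist)
    obtain n where n: "inverse (real (Suc n)) < r" using reals_Archimedean[OF r(1)] by auto
    have "x \<in> F n"
      unfolding F_def
    proof (intro CollectI ballI, rule ccontr)
      fix y assume y: "y \<in> measure_support M" "\<not> inverse (real (Suc n)) \<le> dist x y"
      then have "y \<in> U" using r(2)[of y] n by (simp add: dist_commute)
      then show False using y(1) U by (auto simp: measure_support_def)
    qed
    then show "x \<in> (\<Union>n. F n)" by blast
  qed
  then show ?thesis
    using F_null by (intro AE_I'[of "\<Union>n. F n"]) auto
qed

lemma lip1_functions_iff: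
  "f \<in> lip1_functions \<longleftrightarrow> (\<forall>x y. \<bar>f x - f y\<bar> \<le> dist x y)"
  by (auto simp: lip1_functions_def lipschitz_on_def dist_real_def)

lemma lip1_continuous: "f \<in> lip1_functions \<Longrightarrow> continuous_on UNIV f"
  by (auto simp: lip1_functions_def intro: lipschitz_on_continuous_on)

lemma lip1_borel_measurable: "f \<in> lip1_functions \<Longrightarrow> f \<in> borel_measurable borel"
  by (intro borel_measurable_continuous_onI lip1_continuous)

lemma lip1_bounded:
  fixes f :: "'a::metric_space \<Rightarrow> real"
  assumes "compact (UNIV :: 'a set)" "f \<in> lip1_functions"
  obtains B where "\<And>x. \<bar>f x\<bar> \<le> B"
proof -
  have "bounded (range f)"
    using assms by (intro compact_imp_bounded compact_continuous_image lip1_continuous)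
  then show thesis using that by (auto simp: bounded_iff)
qed

lemma dist_le_diameter:
  fixes x y :: "'a::metric_space"
  assumes "compact (UNIV :: 'a set)"
  shows "dist x y \<le> diameter (UNIV :: 'a set)"
  using assms by (intro diameter_bounded_bound compact_imp_bounded) auto

text \<open>
  A function with mean zero satisfies \<open>f x = \<integral> f x - f y\<close>, and the integrand is bounded by the distance
  of \<open>x\<close> and \<open>y\<close>.
\<close>

lemma centered_lip1_bound:
  fixes M :: "'a::metric_space measure"
  assumes "prob_space M" "compact (UNIV :: 'a set)" and f: "f \<in> centered_lip1 M"
  shows "\<bar>f x\<bar> \<le> diameter (UNIV :: 'a set)"
proof -
  interpret prob_space M by fact
  have int: "integrable M f" "(\<integral>y. f y \<partial>M) = 0"
    using f by (auto simp: centered_lip1_def has_bochner_integral_iff)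
  have lip: "\<bar>f x - f y\<bar> \<le> dist x y" for y
    using f by (simp add: centered_lip1_def lip1_functions_iff)
  have "f x = (\<integral>y. f x - f y \<partial>M)" using int by (simp add: prob_space)
  also have "\<bar>\<dots>\<bar> \<le> (\<integral>y. \<bar>f x - f y\<bar> \<partial>M)" by (rule integral_abs_bound)
  also have "\<dots> \<le> (\<integral>y. diameter (UNIV :: 'a set) \<partial>M)"
    using int lip dist_le_diameter[OF assms(2)]
    by (intro integral_mono) (auto intro: order_trans)
  also have "\<dots> = diameter (UNIV :: 'a set)" by (simp add: prob_space)
  finally show ?thesis .
qed

text \<open>
  The function \<open>k\<close> stands for the part of a coupling metric that measures distances across the two
  spaces. The extension is McShane's formula used twice at once: from \<open>K\<close> to \<open>L\<close> through \<open>k\<close>, and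
  from \<open>L\<close> to the whole second space through \<open>dist\<close>. As an infimum of 1-Lipschitz functions it is
  1-Lipschitz everywhere, although \<open>k\<close> is controlled on \<open>K\<close> and \<open>L\<close> only.
\<close>

lemma lip1_transfer:
  fixes f :: "'a::metric_space \<Rightarrow> real" and k :: "'a \<Rightarrow> 'b::metric_space \<Rightarrow> real"
  assumes comp: "compact (UNIV :: 'a set)" and f: "f \<in> lip1_functions"
    and ne: "K \<noteq> {}" "L \<noteq> {}"
    and k1: "\<And>x y z. x \<in> K \<Longrightarrow> y \<in> L \<Longrightarrow> z \<in> L \<Longrightarrow> k x z \<le> k x y + dist y z"
    and k2: "\<And>x x' z. x \<in> K \<Longrightarrow> x' \<in> K \<Longrightarrow> z \<in> L \<Longrightarrow> dist x x' \<le> k x z + k x' z"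
  obtains g where "g \<in> lip1_functions"
    and "\<And>x z. x \<in> K \<Longrightarrow> z \<in> L \<Longrightarrow> \<bar>f x - g z\<bar> \<le> k x z"
proof -
  obtain B where B: "\<And>x. \<bar>f x\<bar> \<le> B" using lip1_bounded[OF comp f] by blast
  define P where "P = K \<times> L"
  define c where "c z q = f (fst q) + k (fst q) (snd q) + dist (snd q) z" for z q
  define g where "g z = (INF q\<in>P. c z q)" for z
  have P: "P \<noteq> {}" using ne by (auto simp: P_def)
  have k0: "0 \<le> k x y" if "x \<in> K" "y \<in> L" for x y
    using k2[of x x y] that by simp
  have bdd: "bdd_below (c z ` P)" for z
  proof (rule bdd_belowI2)
    fix q assume "q \<in> P"
    then have "0 \<le> k (fst q) (snd q)" using k0 by (simp add: P_def mem_Times_iff)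
    then show "- B \<le> c z q"
      unfolding c_def using B[of "fst q"] zero_le_dist[of "snd q" z] by linarith
  qed
  have le: "g z \<le> g w + dist z w" for z w
  proof -
    have "g z - dist z w \<le> c w q" if "q \<in> P" for q
    proof -
      have "g z \<le> c z q" unfolding g_def using bdd that by (rule cINF_lower)
      then show ?thesis
        using dist_triangle[of "snd q" z w] by (simp add: c_def dist_commute)
    qed
    then have "g z - dist z w \<le> g w" unfolding g_def using P by (intro cINF_greatest) auto
    then show ?thesis by simp
  qed
  have "\<bar>g z - g w\<bar> \<le> dist z w" for z w
    using le[of z w] le[of w z] by (auto simp: dist_commute abs_le_iff)
  then have "g \<in> lip1_functions" by (simp add: lip1_functions_iff)
  moreover have "\<bar>f x - g z\<bar> \<le> k x z" if "x \<in> K" "z \<in> L" for x z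
  proof -
    have "g z \<le> c z (x, z)" unfolding g_def using bdd that by (intro cINF_lower) (auto simp: P_def)
    moreover have "f x - k x z \<le> g z"
      unfolding g_def
    proof (rule cINF_greatest[OF P])
      fix q assume "q \<in> P"
      then have "fst q \<in> K" "snd q \<in> L" by (auto simp: P_def)
      then have "dist x (fst q) \<le> k x z + k (fst q) z"
          "k (fst q) z \<le> k (fst q) (snd q) + dist (snd q) z"
        using that k1 k2 by auto
      moreover have "\<bar>f x - f (fst q)\<bar> \<le> dist x (fst q)"
        using f by (simp add: lip1_functions_iff)
      ultimately show "f x - k x z \<le> c z q" by (simp add: c_def abs_le_iff)
    qed
    ultimately show ?thesis by (simp add: c_def abs_le_iff)
  qed
  ultimately show thesis using that by blast
qed

section \<open>Comparing observables along a coupling\<close>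

text \<open>
  The random points \<open>s\<close> and \<open>t\<close> of the two spaces live on an abstract probability space, rather than
  being the projections of the product: the hypotheses then survive exchanging the spaces, with the
  same \<open>h\<close>. The sets \<open>K\<close> and \<open>L\<close> stand for the supports, \<open>k\<close> for the distance across the
  spaces, and \<open>A\<close> for a bound of the transport cost.
\<close>

locale kernel_coupling = prob_space h for h :: "'c measure" +
  fixes s :: "'c \<Rightarrow> 'a::metric_space" and t :: "'c \<Rightarrow> 'b::metric_space"
    and M :: "'a measure" and N :: "'b measure"
    and K :: "'a set" and L :: "'b set" and k :: "'a \<Rightarrow> 'b \<Rightarrow> real" and p A :: real
  assumes compact_s: "compact (UNIV :: 'a set)" and compact_t: "compact (UNIV :: 'b set)"
    and s_measurable [measurable]: "s \<in> h \<rightarrow>\<^sub>M borel" and t_measurable [measurable]: "t \<in> h \<rightarrow>\<^sub>M borel"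
    and distr_s: "distr h borel s = M" and distr_t: "distr h borel t = N"
    and AE_s: "AE z in h. s z \<in> K" and AE_t: "AE z in h. t z \<in> L"
    and kernel_t: "\<And>x y z. x \<in> K \<Longrightarrow> y \<in> L \<Longrightarrow> z \<in> L \<Longrightarrow> k x z \<le> k x y + dist y z"
    and kernel_s: "\<And>x x' y. x \<in> K \<Longrightarrow> x' \<in> K \<Longrightarrow> y \<in> L \<Longrightarrow> k x' y \<le> k x y + dist x x'"
    and dist_s_le: "\<And>x x' y. x \<in> K \<Longrightarrow> x' \<in> K \<Longrightarrow> y \<in> L \<Longrightarrow> dist x x' \<le> k x y + k x' y"
    and dist_t_le: "\<And>x y z. x \<in> K \<Longrightarrow> y \<in> L \<Longrightarrow> z \<in> L \<Longrightarrow> dist y z \<le> k x y + k x z"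
    and p_ge_1: "1 \<le> p" and A_nonneg: "0 \<le> A"
    and cost: "(\<integral>\<^sup>+z. ennreal (k (s z) (t z) powr p) * indicator (K \<times> L) (s z, t z) \<partial>h)
                 \<le> ennreal (A powr p)"
begin

lemma flip: "kernel_coupling h t s N M L K (\<lambda>y x. k x y) p A"
proof unfold_locales
  have "indicator (L \<times> K) (t z, s z) = (indicator (K \<times> L) (s z, t z) :: ennreal)" for z
    by (auto simp: indicator_def)
  then show "(\<integral>\<^sup>+z. ennreal (k (s z) (t z) powr p) * indicator (L \<times> K) (t z, s z) \<partial>h)
      \<le> ennreal (A powr p)" using cost by simp
qed (use compact_s compact_t distr_s distr_t AE_s AE_t kernel_t kernel_s dist_s_le dist_t_le
      p_ge_1 A_nonneg in auto)

text \<open>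
  All functions to be compared are bounded and measurable, which settles every integrability
  question below.
\<close>

definition bounded_fun :: "('c \<Rightarrow> real) \<Rightarrow> bool" where
  "bounded_fun u \<longleftrightarrow> u \<in> borel_measurable h \<and> (\<exists>B. \<forall>z. \<bar>u z\<bar> \<le> B)"

lemma bounded_fun_integrable:
  assumes "bounded_fun u"
  shows "integrable h u"
proof -
  obtain B where "\<And>z. \<bar>u z\<bar> \<le> B" using assms by (auto simp: bounded_fun_def)
  then show ?thesis
    using assms by (intro integrable_const_bound[of _ B]) (auto simp: bounded_fun_def)
qed

lemma bounded_fun_diff:
  assumes "bounded_fun u" "bounded_fun v"
  shows "bounded_fun (\<lambda>z. u z - v z)"
proof -
  obtain B C where B: "\<And>z. \<bar>u z\<bar> \<le> B" and C: "\<And>z. \<bar>v z\<bar> \<le> C"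
    using assms by (auto simp: bounded_fun_def)
  have "\<bar>u z - v z\<bar> \<le> B + C" for z
    using B[of z] C[of z] by linarith
  then show ?thesis using assms by (auto simp: bounded_fun_def)
qed

lemma bounded_fun_mult:
  assumes "bounded_fun u" "bounded_fun v"
  shows "bounded_fun (\<lambda>z. u z * v z)"
proof -
  obtain B C where B: "\<And>z. \<bar>u z\<bar> \<le> B" and C: "\<And>z. \<bar>v z\<bar> \<le> C"
    using assms by (auto simp: bounded_fun_def)
  have "\<bar>u z * v z\<bar> \<le> B * C" for z
    unfolding abs_mult using B C order_trans[OF abs_ge_zero B] by (intro mult_mono) auto
  then show ?thesis using assms by (auto simp: bounded_fun_def)
qed

lemma bounded_fun_powr:
  assumes "bounded_fun u"
  shows "bounded_fun (\<lambda>z. \<bar>u z\<bar> powr p)"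
proof -
  obtain B where B: "\<And>z. \<bar>u z\<bar> \<le> B" using assms by (auto simp: bounded_fun_def)
  have "\<bar>\<bar>u z\<bar> powr p\<bar> \<le> B powr p" for z
    using B[of z] p_ge_1 by (auto intro!: powr_mono2)
  then show ?thesis using assms by (auto simp: bounded_fun_def)
qed

lemma integrable_powr_diff:
  assumes "bounded_fun u" "bounded_fun v"
  shows "integrable h (\<lambda>z. \<bar>u z - v z\<bar> powr p)"
  by (intro bounded_fun_integrable bounded_fun_powr bounded_fun_diff assms)

lemma integrable_abs_diff:
  assumes "bounded_fun u" "bounded_fun v"
  shows "integrable h (\<lambda>z. \<bar>u z - v z\<bar>)"
  by (intro integrable_abs bounded_fun_integrable bounded_fun_diff assms)

lemma triangle:
  assumes "bounded_fun u" "bounded_fun v" "bounded_fun w"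
  shows "Lp_dist p h u w \<le> Lp_dist p h u v + Lp_dist p h v w"
  by (intro Lp_dist_triangle p_ge_1 integrable_powr_diff assms)

lemma L1_le:
  assumes "bounded_fun u" "bounded_fun v"
  shows "(\<integral>z. \<bar>u z - v z\<bar> \<partial>h) \<le> Lp_dist p h u v"
  by (intro integral_abs_le_Lp_dist p_ge_1 integrable_powr_diff integrable_abs_diff assms)

lemma bounded_fun_s: "f \<in> lip1_functions \<Longrightarrow> bounded_fun (\<lambda>z. f (s z))"
  unfolding bounded_fun_def
  by (rule conjI, erule measurable_compose[OF s_measurable lip1_borel_measurable],
      erule lip1_bounded[OF compact_s], blast)

lemma bounded_fun_t: "g \<in> lip1_functions \<Longrightarrow> bounded_fun (\<lambda>z. g (t z))"
  unfolding bounded_fun_def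
  by (rule conjI, erule measurable_compose[OF t_measurable lip1_borel_measurable],
      erule lip1_bounded[OF compact_t], blast)

text \<open>
  The transferred function is within \<open>A\<close> of \<open>f\<close>, and its mean is at most \<open>A\<close> in absolute value, because
  \<open>f\<close> has mean zero and \<open>L\<^sup>1\<close> norms are bounded by \<open>L\<^sup>p\<close> norms. This gives the factor 2.
\<close>

lemma exists_partner:
  assumes f: "f \<in> centered_lip1 M"
  obtains g where "g \<in> centered_lip1 N" and "Lp_dist p h (\<lambda>z. f (s z)) (\<lambda>z. g (t z)) \<le> 2 * A"
proof -
  have f_lip: "f \<in> lip1_functions" and f0: "(\<integral>x. f x \<partial>M) = 0"
    using f by (auto simp: centered_lip1_def has_bochner_integral_iff)
  have AEKL: "AE z in h. s z \<in> K \<and> t z \<in> L" using AE_s AE_t by eventually_elim auto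
  have "\<exists>z. s z \<in> K \<and> t z \<in> L"
    using eventually_happens'[OF ae_filter_bot AEKL] by blast
  then have ne: "K \<noteq> {}" "L \<noteq> {}" by auto
  obtain g where g: "g \<in> lip1_functions"
    and gk: "\<And>x z. x \<in> K \<Longrightarrow> z \<in> L \<Longrightarrow> \<bar>f x - g z\<bar> \<le> k x z"
    using lip1_transfer[of f K L k] compact_s f_lip ne kernel_t dist_s_le by metis
  let ?f = "\<lambda>z. f (s z)" and ?g = "\<lambda>z. g (t z)"
  have bf: "bounded_fun ?f" and bg: "bounded_fun ?g"
    using bounded_fun_s[OF f_lip] bounded_fun_t[OF g] by auto
  (* The comparison with the kernel is made for nonnegative integrals: these are monotone
     for arbitrary functions, and nothing ties k to the Borel sets. *)
  have fg: "Lp_dist p h ?f ?g \<le> A"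
  proof (subst Lp_dist_le_iff[OF p_ge_1 A_nonneg])
    have "ennreal (\<integral>z. \<bar>?f z - ?g z\<bar> powr p \<partial>h) = (\<integral>\<^sup>+z. ennreal (\<bar>?f z - ?g z\<bar> powr p) \<partial>h)"
      using integrable_powr_diff[OF bf bg] by (intro nn_integral_eq_integral [symmetric]) auto
    also have "\<dots> \<le> (\<integral>\<^sup>+z. ennreal (k (s z) (t z) powr p) * indicator (K \<times> L) (s z, t z) \<partial>h)"
    proof (rule nn_integral_mono_AE, use AEKL in eventually_elim)
      case (elim z)
      then show ?case using gk p_ge_1 by (auto intro!: ennreal_leI powr_mono2)
    qed
    also note cost
    finally show "(\<integral>z. \<bar>?f z - ?g z\<bar> powr p \<partial>h) \<le> A powr p"
      by (simp add: ennreal_le_iff)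
  qed
  define m where "m = (\<integral>y. g y \<partial>N)"
  have m: "m = (\<integral>z. ?g z \<partial>h)"
    unfolding m_def distr_t [symmetric]
    by (intro integral_distr t_measurable lip1_borel_measurable g)
  have f0': "(\<integral>z. ?f z \<partial>h) = 0"
    using f0 unfolding distr_s [symmetric]
    by (simp add: integral_distr s_measurable lip1_borel_measurable f_lip)
  have "\<bar>m\<bar> = \<bar>\<integral>z. ?f z - ?g z \<partial>h\<bar>"
    using bf bg bounded_fun_integrable f0' m by simp
  also have "\<dots> \<le> (\<integral>z. \<bar>?f z - ?g z\<bar> \<partial>h)" by (rule integral_abs_bound)
  also have "\<dots> \<le> A" using L1_le[OF bf bg] fg by simp
  finally have mA: "\<bar>m\<bar> \<le> A" .
  define g' where "g' y = g y - m" for y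
  have g'lip: "g' \<in> lip1_functions" using g by (simp add: g'_def lip1_functions_iff)
  have intg: "integrable N g"
    using bounded_fun_integrable[OF bg] unfolding distr_t [symmetric]
    by (subst integrable_distr_eq) (auto intro: lip1_borel_measurable g)
  interpret N: prob_space N
    unfolding distr_t [symmetric] by (intro prob_space_distr t_measurable)
  have "has_bochner_integral N (\<lambda>y. g y - m) 0"
    using intg by (simp add: has_bochner_integral_iff N.prob_space m_def)
  then have "has_bochner_integral N g' 0" by (simp add: g'_def [abs_def])
  then have "g' \<in> centered_lip1 N" using g'lip by (simp add: centered_lip1_def)
  moreover have "Lp_dist p h ?f (\<lambda>z. g' (t z)) \<le> 2 * A"
  proof -
    have "Lp_dist p h ?g (\<lambda>z. g' (t z)) \<le> A"
      using mA A_nonneg p_ge_1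
      by (subst Lp_dist_le_iff) (auto simp: g'_def prob_space intro!: powr_mono2)
    then show ?thesis using triangle[OF bf bg bounded_fun_t[OF g'lip]] fg by simp
  qed
  ultimately show thesis using that by blast
qed

lemma Lp_dist_s:
  assumes "f \<in> lip1_functions" "g \<in> lip1_functions"
  shows "Lp_dist p M f g = Lp_dist p h (\<lambda>z. f (s z)) (\<lambda>z. g (s z))"
proof -
  have [measurable]: "f \<in> borel_measurable borel" "g \<in> borel_measurable borel"
    using assms by (auto intro: lip1_borel_measurable)
  show ?thesis
    unfolding Lp_dist_def distr_s [symmetric] by (subst integral_distr) auto
qed

lemma obs_cov_s:
  assumes "f \<in> lip1_functions" "g \<in> lip1_functions"
  shows "obs_cov M (f, g) = (\<integral>z. f (s z) * g (s z) \<partial>h)"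
proof -
  have [measurable]: "f \<in> borel_measurable borel" "g \<in> borel_measurable borel"
    using assms by (auto intro: lip1_borel_measurable)
  show ?thesis
    unfolding obs_cov_def distr_s [symmetric] by (subst integral_distr) auto
qed

definition close :: "(('a \<Rightarrow> real) \<times> ('b \<Rightarrow> real)) set" where
  "close = {(f, g). f \<in> centered_lip1 M \<and> g \<in> centered_lip1 N \<and>
     Lp_dist p h (\<lambda>z. f (s z)) (\<lambda>z. g (t z)) \<le> 2 * A}"

text \<open>
  Inside \<open>L\<^sup>p(h)\<close> all four functions live in one pseudo metric space, where moving both arguments by
  \<open>2 * A\<close> changes their distance by at most \<open>4 * A\<close>.
\<close>

lemma close_Lp_dist:
  assumes "(f, f') \<in> close" "(g, g') \<in> close"
  shows "\<bar>Lp_dist p M f g - Lp_dist p N f' g'\<bar> \<le> 4 * A"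
proof -
  interpret flip: kernel_coupling h t s N M L K "\<lambda>y x. k x y" p A by (rule flip)
  have lip: "f \<in> lip1_functions" "g \<in> lip1_functions" "f' \<in> lip1_functions" "g' \<in> lip1_functions"
    using assms by (auto simp: close_def centered_lip1_def)
  let ?f = "\<lambda>z. f (s z)" and ?g = "\<lambda>z. g (s z)" and ?f' = "\<lambda>z. f' (t z)" and ?g' = "\<lambda>z. g' (t z)"
  have b: "bounded_fun ?f" "bounded_fun ?g" "bounded_fun ?f'" "bounded_fun ?g'"
    using lip by (auto intro: bounded_fun_s bounded_fun_t)
  have c: "Lp_dist p h ?f ?f' \<le> 2 * A" "Lp_dist p h ?g ?g' \<le> 2 * A"
    using assms by (auto simp: close_def)
  have "Lp_dist p h ?f ?g \<le> Lp_dist p h ?f ?f' + (Lp_dist p h ?f' ?g' + Lp_dist p h ?g' ?g)"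
    using triangle[OF b(1) b(3) b(2)] triangle[OF b(3) b(4) b(2)] by simp
  moreover have "Lp_dist p h ?f' ?g' \<le> Lp_dist p h ?f' ?f + (Lp_dist p h ?f ?g + Lp_dist p h ?g ?g')"
    using triangle[OF b(3) b(1) b(4)] triangle[OF b(1) b(2) b(4)] by simp
  ultimately have "\<bar>Lp_dist p h ?f ?g - Lp_dist p h ?f' ?g'\<bar> \<le> 4 * A"
    using c Lp_dist_commute[of p h ?f ?f'] Lp_dist_commute[of p h ?g ?g'] by linarith
  then show ?thesis using lip by (simp add: Lp_dist_s flip.Lp_dist_s)
qed

text \<open>
  In the decomposition of the difference of the products, one factor is bounded by a diameter and the
  other is small in \<open>L\<^sup>1(h)\<close>. Each product uses one function of each space, which is why the diameters
  are added.
\<close>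

lemma close_obs_cov:
  assumes "(f, f') \<in> close" "(g, g') \<in> close"
  shows "\<bar>obs_cov M (f, g) - obs_cov N (f', g')\<bar>
    \<le> 2 * (diameter (UNIV :: 'a set) + diameter (UNIV :: 'b set)) * A"
proof -
  interpret flip: kernel_coupling h t s N M L K "\<lambda>y x. k x y" p A by (rule flip)
  define D where "D = diameter (UNIV :: 'a set)"
  define D' where "D' = diameter (UNIV :: 'b set)"
  have D: "0 \<le> D" "0 \<le> D'"
    using compact_s compact_t by (auto simp: D_def D'_def intro!: diameter_ge_0 compact_imp_bounded)
  have lip: "f \<in> lip1_functions" "g \<in> lip1_functions" "f' \<in> lip1_functions" "g' \<in> lip1_functions"
    using assms by (auto simp: close_def centered_lip1_def)
  let ?f = "\<lambda>z. f (s z)" and ?g = "\<lambda>z. g (s z)" and ?f' = "\<lambda>z. f' (t z)" and ?g' = "\<lambda>z. g' (t z)"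
  have b: "bounded_fun ?f" "bounded_fun ?g" "bounded_fun ?f'" "bounded_fun ?g'"
    using lip by (auto intro: bounded_fun_s bounded_fun_t)
  have c: "(\<integral>z. \<bar>?f z - ?f' z\<bar> \<partial>h) \<le> 2 * A" "(\<integral>z. \<bar>?g z - ?g' z\<bar> \<partial>h) \<le> 2 * A"
    using assms L1_le[OF b(1) b(3)] L1_le[OF b(2) b(4)] by (auto simp: close_def)
  have fD: "\<bar>f x\<bar> \<le> D" for x
    using assms centered_lip1_bound[of M f x] compact_s distr_s prob_space_distr[OF s_measurable]
    by (auto simp: close_def D_def)
  have gD: "\<bar>g' x\<bar> \<le> D'" for x
    using assms centered_lip1_bound[of N g' x] compact_t distr_t prob_space_distr[OF t_measurable]
    by (auto simp: close_def D'_def)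
  have i: "integrable h (\<lambda>z. ?f z * ?g z)" "integrable h (\<lambda>z. ?f' z * ?g' z)"
    by (intro bounded_fun_integrable bounded_fun_mult b)+
  have "\<bar>obs_cov M (f, g) - obs_cov N (f', g')\<bar> = \<bar>\<integral>z. ?f z * ?g z - ?f' z * ?g' z \<partial>h\<bar>"
    using lip i by (simp add: obs_cov_s flip.obs_cov_s)
  also have "\<dots> \<le> (\<integral>z. \<bar>?f z * ?g z - ?f' z * ?g' z\<bar> \<partial>h)" by (rule integral_abs_bound)
  also have "\<dots> \<le> (\<integral>z. D * \<bar>?g z - ?g' z\<bar> + D' * \<bar>?f z - ?f' z\<bar> \<partial>h)"
  proof (rule integral_mono)
    fix z
    have "?f z * ?g z - ?f' z * ?g' z = ?f z * (?g z - ?g' z) + ?g' z * (?f z - ?f' z)"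
      by (simp add: algebra_simps)
    also have "\<bar>\<dots>\<bar> \<le> \<bar>?f z\<bar> * \<bar>?g z - ?g' z\<bar> + \<bar>?g' z\<bar> * \<bar>?f z - ?f' z\<bar>"
      unfolding abs_mult [symmetric] by (rule abs_triangle_ineq)
    also have "\<dots> \<le> D * \<bar>?g z - ?g' z\<bar> + D' * \<bar>?f z - ?f' z\<bar>"
      by (intro add_mono mult_right_mono fD gD) auto
    finally show "\<bar>?f z * ?g z - ?f' z * ?g' z\<bar> \<le> D * \<bar>?g z - ?g' z\<bar> + D' * \<bar>?f z - ?f' z\<bar>" .
  next
    show "integrable h (\<lambda>z. \<bar>?f z * ?g z - ?f' z * ?g' z\<bar>)"
      using i by (intro integrable_abs Bochner_Integration.integrable_diff)
    show "integrable h (\<lambda>z. D * \<bar>?g z - ?g' z\<bar> + D' * \<bar>?f z - ?f' z\<bar>)"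
      using b by (intro Bochner_Integration.integrable_add integrable_mult_right integrable_abs_diff)
  qed
  also have "\<dots> = D * (\<integral>z. \<bar>?g z - ?g' z\<bar> \<partial>h) + D' * (\<integral>z. \<bar>?f z - ?f' z\<bar> \<partial>h)"
    using b by (simp add: integrable_abs_diff)
  also have "\<dots> \<le> D * (2 * A) + D' * (2 * A)"
    using c D by (intro add_mono mult_left_mono)
  finally show ?thesis by (simp add: D_def D'_def algebra_simps)
qed

text \<open>
  The relation \<open>R\<close> pairs observables componentwise. Existence of partners for observables of the
  second space is the same statement as for the first, with the spaces exchanged.
\<close>

lemma GH_obs_cov_le:
  "GH_obs_cov p M N \<le>
    ennreal (max 2 (2 * (diameter (UNIV :: 'a set) + diameter (UNIV :: 'b set))) * A)"
proof -
  interpret flip: kernel_coupling h t s N M L K "\<lambda>y x. k x y" p A by (rule flip)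
  define D where "D = diameter (UNIV :: 'a set) + diameter (UNIV :: 'b set)"
  define C where "C = max 2 (2 * D)"
  define R where "R = {((f, g), (f', g')) | f g f' g'. (f, f') \<in> close \<and> (g, g') \<in> close}"
  let ?Z = "centered_lip1 M \<times> centered_lip1 M" and ?W = "centered_lip1 N \<times> centered_lip1 N"
  have ex1: "\<exists>g. (f, g) \<in> close" if f: "f \<in> centered_lip1 M" for f
    using exists_partner[OF f] f unfolding close_def by blast
  have ex2: "\<exists>f. (f, g) \<in> close" if g: "g \<in> centered_lip1 N" for g
  proof -
    obtain f where "f \<in> centered_lip1 M" "Lp_dist p h (\<lambda>z. g (t z)) (\<lambda>z. f (s z)) \<le> 2 * A"
      using flip.exists_partner[OF g] by blast
    then show ?thesis using g by (auto simp: close_def Lp_dist_commute)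
  qed
  have R: "R \<in> correspondences ?Z ?W"
  proof -
    have sub: "R \<subseteq> ?Z \<times> ?W" by (auto simp: R_def close_def)
    have "u \<in> fst ` R" if u: "u \<in> ?Z" for u
    proof -
      obtain f' g' where "(fst u, f') \<in> close" "(snd u, g') \<in> close"
        using ex1[of "fst u"] ex1[of "snd u"] u mem_Times_iff by metis
      then have "(u, (f', g')) \<in> R" by (cases u) (auto simp: R_def)
      then show ?thesis by force
    qed
    moreover have "u \<in> snd ` R" if u: "u \<in> ?W" for u
    proof -
      obtain f g where "(f, fst u) \<in> close" "(g, snd u) \<in> close"
        using ex2[of "fst u"] ex2[of "snd u"] u mem_Times_iff by metis
      then have "((f, g), u) \<in> R" by (cases u) (auto simp: R_def)
      then show ?thesis by force
    qed
    ultimately show ?thesis using sub by (fastforce simp: correspondences_def)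
  qed
  have "dis (pair_dist p M) (pair_dist p N) R \<le> ennreal (4 * A)"
    unfolding dis_def
  proof (rule SUP_least, clarsimp, rule ennreal_leI)
    fix f1 g1 f1' g1' f2 g2 f2' g2'
    assume "((f1, g1), f1', g1') \<in> R" "((f2, g2), f2', g2') \<in> R"
    then have "\<bar>Lp_dist p M f1 f2 - Lp_dist p N f1' f2'\<bar> \<le> 4 * A"
        "\<bar>Lp_dist p M g1 g2 - Lp_dist p N g1' g2'\<bar> \<le> 4 * A"
      by (auto simp: R_def intro: close_Lp_dist)
    then show "\<bar>pair_dist p M (f1, g1) (f2, g2) - pair_dist p N (f1', g1') (f2', g2')\<bar> \<le> 4 * A"
      by (auto simp: pair_dist_def max_def abs_le_iff)
  qed
  also have "4 * A \<le> 2 * (C * A)"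
    using A_nonneg mult_right_mono[of 2 C A] by (simp add: C_def mult.commute)
  finally have d1: "dis (pair_dist p M) (pair_dist p N) R \<le> ennreal (2 * (C * A))"
    by (simp add: ennreal_leI)
  have "fdis (obs_cov M) (obs_cov N) R \<le> ennreal (2 * D * A)"
    unfolding fdis_def
  proof (rule SUP_least, clarsimp, rule ennreal_leI)
    fix f g f' g'
    assume "((f, g), f', g') \<in> R"
    then show "\<bar>obs_cov M (f, g) - obs_cov N (f', g')\<bar> \<le> 2 * D * A"
      using close_obs_cov by (auto simp: R_def D_def)
  qed
  also have "2 * D * A \<le> C * A"
    using A_nonneg by (intro mult_right_mono) (auto simp: C_def)
  finally have "fdis (obs_cov M) (obs_cov N) R \<le> ennreal (C * A)"
    by (simp add: ennreal_leI)
  then have "2 * fdis (obs_cov M) (obs_cov N) R \<le> 2 * ennreal (C * A)"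
    by (rule mult_left_mono) simp
  also have "\<dots> = ennreal (2 * (C * A))"
    using A_nonneg by (simp add: ennreal_mult C_def)
  finally have d2: "2 * fdis (obs_cov M) (obs_cov N) R \<le> ennreal (2 * (C * A))" .
  have "GH_obs_cov p M N
      \<le> max (dis (pair_dist p M) (pair_dist p N) R) (2 * fdis (obs_cov M) (obs_cov N) R) / 2"
    unfolding GH_obs_cov_def GH_fun_dist_def by (intro divide_right_mono_ennreal INF_lower R)
  also have "\<dots> \<le> ennreal (2 * (C * A)) / 2"
    using d1 d2 by (intro divide_right_mono_ennreal) auto
  also have "\<dots> = ennreal (C * A)"
    using A_nonneg by (subst ennreal_divide_numeral) (auto simp: C_def)
  finally show ?thesis by (simp add: C_def D_def)
qed

end

section \<open>From couplings to the Kantorovich-Sturm distance\<close>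

text \<open>
  The triangle inequalities of \<open>\<delta>\<close>, together with its agreement with the given metrics on the
  supports, are exactly what the locale asks of the distance across the spaces. An infinite cost
  has to be treated apart, since there is no real number \<open>A\<close> then.
\<close>

lemma GH_obs_cov_le_KS_cost:
  fixes M :: "'a::metric_space measure" and N :: "'b::metric_space measure"
  assumes M: "prob_space M" "sets M = sets borel" "compact (UNIV :: 'a set)"
    and N: "prob_space N" "sets N = sets borel" "compact (UNIV :: 'b set)"
    and p: "p \<ge> 1"
    and h: "h \<in> measure_couplings M N" and d: "\<delta> \<in> metric_couplings M N"
  shows "GH_obs_cov p M N \<le>
    ennreal (max 2 (2 * (diameter (UNIV :: 'a set) + diameter (UNIV :: 'b set)))) * KS_cost p M N h \<delta>"
proof -
  define C where "C = max 2 (2 * (diameter (UNIV :: 'a set) + diameter (UNIV :: 'b set)))"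
  have C: "C \<ge> 2" by (simp add: C_def)
  define I where "I = (\<integral>\<^sup>+z\<in>measure_support M \<times> measure_support N.
    ennreal (\<delta> (Inl (fst z)) (Inr (snd z)) powr p) \<partial>h)"
  show ?thesis
  proof (cases "I = \<infinity>")
    case True
    then have "KS_cost p M N h \<delta> = \<infinity>" by (simp add: KS_cost_def ennreal_root_def I_def)
    then show ?thesis using C by (simp add: C_def [symmetric] ennreal_mult_top)
  next
    case False
    define A where "A = enn2real I powr (1 / p)"
    have cost: "KS_cost p M N h \<delta> = ennreal A"
      using False by (simp add: KS_cost_def ennreal_root_def I_def A_def)
    have hp: "prob_space h" and sh: "sets h = sets borel"
      and hM: "distr h borel fst = M" and hN: "distr h borel snd = N"
      using h by (auto simp: measure_couplings_def)
    interpret D: Metric_space UNIV \<delta> using d by (simp add: metric_couplings_def)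
    have dM: "\<delta> (Inl x) (Inl y) = dist x y" if "x \<in> measure_support M" "y \<in> measure_support M" for x y
      using d that by (simp add: metric_couplings_def)
    have dN: "\<delta> (Inr x) (Inr y) = dist x y" if "x \<in> measure_support N" "y \<in> measure_support N" for x y
      using d that by (simp add: metric_couplings_def)
    have meas: "fst \<in> h \<rightarrow>\<^sub>M borel" "snd \<in> h \<rightarrow>\<^sub>M borel"
      unfolding measurable_cong_sets[OF sh refl]
      by (auto intro!: borel_measurable_continuous_onI continuous_intros)
    have "kernel_coupling h fst snd M N (measure_support M) (measure_support N)
        (\<lambda>x y. \<delta> (Inl x) (Inr y)) p A"
    proof (intro kernel_coupling.intro kernel_coupling_axioms.intro)
      show "AE z in h. fst z \<in> measure_support M"
        using meas(1) AE_in_measure_support[OF M(2,3)] unfolding hM [symmetric] by (rule AE_distrD)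
      show "AE z in h. snd z \<in> measure_support N"
        using meas(2) AE_in_measure_support[OF N(2,3)] unfolding hN [symmetric] by (rule AE_distrD)
      show "0 \<le> A" by (simp add: A_def)
      have "ennreal (A powr p) = I"
        using False p by (simp add: A_def powr_powr ennreal_enn2real top.not_eq_extremum)
      then show "(\<integral>\<^sup>+z. ennreal (\<delta> (Inl (fst z)) (Inr (snd z)) powr p)
          * indicator (measure_support M \<times> measure_support N) (fst z, snd z) \<partial>h)
          \<le> ennreal (A powr p)"
        by (simp add: I_def)
    next
      fix x y z assume "x \<in> measure_support M" "y \<in> measure_support N" "z \<in> measure_support N"
      then show "\<delta> (Inl x) (Inr z) \<le> \<delta> (Inl x) (Inr y) + dist y z"
          and "dist y z \<le> \<delta> (Inl x) (Inr y) + \<delta> (Inl x) (Inr z)"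
        using D.triangle[of "Inl x" "Inr y" "Inr z"] D.triangle[of "Inr y" "Inl x" "Inr z"]
        by (simp_all add: dN D.commute)
    next
      fix x x' y assume "x \<in> measure_support M" "x' \<in> measure_support M" "y \<in> measure_support N"
      then show "\<delta> (Inl x') (Inr y) \<le> \<delta> (Inl x) (Inr y) + dist x x'"
          and "dist x x' \<le> \<delta> (Inl x) (Inr y) + \<delta> (Inl x') (Inr y)"
        using D.triangle[of "Inl x'" "Inl x" "Inr y"] D.triangle[of "Inl x" "Inr y" "Inl x'"]
        by (simp_all add: dM D.commute dist_commute)
    qed (use M N p hp hM hN meas in auto)
    from kernel_coupling.GH_obs_cov_le[OF this]
    have "GH_obs_cov p M N \<le> ennreal (C * A)" by (simp add: C_def)
    also have "\<dots> = ennreal C * KS_cost p M N h \<delta>"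
      using C by (simp add: cost ennreal_mult A_def)
    finally show ?thesis by (simp add: C_def)
  qed
qed

text \<open>
  The constant is positive and finite, so it can be moved to the other side of the inequality, where
  it does not interfere with the infimum over the couplings.
\<close>

theorem theorem6p6:
  fixes \<mu> :: "'a::metric_space measure" and \<mu>' :: "'b::metric_space measure" and p :: real
  assumes "prob_space \<mu>" and "sets \<mu> = sets borel" and "compact (UNIV :: 'a set)"
    and "prob_space \<mu>'" and "sets \<mu>' = sets borel" and "compact (UNIV :: 'b set)"
    and "p \<ge> 1"
  shows "GH_obs_cov p \<mu> \<mu>' \<le>
    ennreal (max 2 (2 * (diameter (UNIV :: 'a set) + diameter (UNIV :: 'b set)))) * KS_dist p \<mu> \<mu>'"
proof -
  define C where "C = max 2 (2 * (diameter (UNIV :: 'a set) + diameter (UNIV :: 'b set)))"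
  have "C > 0" by (simp add: C_def less_max_iff_disj)
  then have C: "ennreal C \<noteq> 0" "ennreal C \<noteq> top" by simp_all
  have "GH_obs_cov p \<mu> \<mu>' / ennreal C \<le> KS_dist p \<mu> \<mu>'"
    unfolding KS_dist_def
  proof (rule INF_greatest, clarify)
    fix h \<delta> assume "h \<in> measure_couplings \<mu> \<mu>'" "\<delta> \<in> metric_couplings \<mu> \<mu>'"
    then have "GH_obs_cov p \<mu> \<mu>' \<le> ennreal C * KS_cost p \<mu> \<mu>' h \<delta>"
      unfolding C_def by (intro GH_obs_cov_le_KS_cost assms)
    then show "GH_obs_cov p \<mu> \<mu>' / ennreal C \<le> KS_cost p \<mu> \<mu>' h \<delta>"
      using C by (intro divide_le_posI_ennreal) (auto simp: zero_less_iff_neq_zero)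
  qed
  then have "ennreal C * (GH_obs_cov p \<mu> \<mu>' / ennreal C) \<le> ennreal C * KS_dist p \<mu> \<mu>'"
    by (rule mult_left_mono) simp
  also have "ennreal C * (GH_obs_cov p \<mu> \<mu>' / ennreal C) = GH_obs_cov p \<mu> \<mu>'"
    unfolding ennreal_times_divide by (subst mult.commute) (rule ennreal_mult_divide_eq[OF C])
  finally show ?thesis by (simp add: C_def)
qed

end
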